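(* For any bound $k \in \mathbb{N}$ and finite sets of atomic propositions $\mathit{AP}$ and $I$ with $\emptyset \neq I \subseteq \mathit{AP}$, every nondeterministic finite automaton over the alphabet $\Sigma = 2^{\mathit{AP}}$ that recognizes $L = \{ w \in \Sigma^* \mid \exists \sigma \in L_k^I(\Sigma^\omega).\ w \text{ is a prefix of } \sigma\}$ has at least $2^{\Omega(k)}$ states.
   Context: For $\sigma \in \Sigma^\omega$, $\sigma|_I \in (2^I)^\omega$ is its projection onto $I$. $L_k^I(\Sigma^\omega)$ is the set of all $\sigma \in \Sigma^\omega$ for which there exist finite words $u \in (2^I)^*$ and $v \in (2^I)^+$ with $|u \cdot v| = k$ and $\sigma|_I = u \cdot v^\omega$. *)

theory Defs
  imports Complex_Main "HOL-Library.Stream" "HOL-Library.Landau_Symbols"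
begin

record ('q, 'l) nfa =
  states :: "'q set"
  initial :: "'q set"
  trans :: "'q \<Rightarrow> 'l \<Rightarrow> 'q set"
  accepting :: "'q set"

definition nfa_over :: "'l set \<Rightarrow> ('q, 'l) nfa \<Rightarrow> bool" where
  "nfa_over \<Sigma> A \<longleftrightarrow>
     finite (states A) \<and> states A \<noteq> {} \<and>
     initial A \<subseteq> states A \<and> accepting A \<subseteq> states A \<and>
     (\<forall>q\<in>states A. \<forall>a\<in>\<Sigma>. trans A q a \<subseteq> states A)"

primrec nfa_path :: "('q, 'l) nfa \<Rightarrow> 'q \<Rightarrow> 'l list \<Rightarrow> 'q \<Rightarrow> bool" where
  "nfa_path A p [] q \<longleftrightarrow> p = q"
| "nfa_path A p (a # w) q \<longleftrightarrow> (\<exists>r\<in>trans A p a. nfa_path A r w q)"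

definition nfa_language :: "'l set \<Rightarrow> ('q, 'l) nfa \<Rightarrow> 'l list set" where
  "nfa_language \<Sigma> A =
     {w \<in> lists \<Sigma>. \<exists>p\<in>initial A. \<exists>q\<in>accepting A. nfa_path A p w q}"

definition proj :: "'a set \<Rightarrow> 'a set stream \<Rightarrow> 'a set stream" where
  "proj I \<sigma> = smap (\<lambda>a. a \<inter> I) \<sigma>"

(* Only the projection onto I has to be a lasso of size k;
   the propositions outside I are unconstrained. *)
definition lasso_words :: "nat \<Rightarrow> 'a set \<Rightarrow> 'a set stream set \<Rightarrow> 'a set stream set" where
  "lasso_words k I S =
     {\<sigma> \<in> S. \<exists>u\<in>lists (Pow I). \<exists>v\<in>lists (Pow I).
        v \<noteq> [] \<and> length (u @ v) = k \<and> proj I \<sigma> = u @- cycle v}"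

definition lasso_prefixes :: "nat \<Rightarrow> 'a set \<Rightarrow> 'a set \<Rightarrow> 'a set list set" where
  "lasso_prefixes k I AP =
     {w \<in> lists (Pow AP). \<exists>\<sigma>\<in>lasso_words k I (streams (Pow AP)). \<exists>n. w = stake n \<sigma>}"

(* "At least 2^Omega(k)" for a quantity q(k) is rendered as 2 powr f k \<le> q(k) for some
   f \<in> \<Omega>(k). The library's \<Omega> only compares norms, so that f k = - k would qualify;
   hence nonnegativity of f is required separately. *)
definition linear_lower_growth :: "(nat \<Rightarrow> real) \<Rightarrow> bool" where
  "linear_lower_growth f \<longleftrightarrow> (\<forall>k. 0 \<le> f k) \<and> f \<in> \<Omega>(\<lambda>k. real k)"

end

(* Fooling-set argument. Let y = 0^m 1 z with m = |y| div 2. No p < |y| with p > 0 is a period of y y,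
   so if a lasso of size |y| has a prefix x y y with |x| = |y|, its loop has length |y|, and x = y.
   Hence the states reached after y on accepting runs on y y y are distinct for distinct z,
   and there are 2^(|y| - m - 1) choices of z. *)
theory Submission imports Defs begin

lemma nfa_path_append:
  "nfa_path A p (x @ y) q \<longleftrightarrow> (\<exists>r. nfa_path A p x r \<and> nfa_path A r y q)"
  by (induction x arbitrary: p) auto

lemma nfa_path_in_states:
  assumes "nfa_over \<Sigma> A" "nfa_path A p w q" "p \<in> states A" "w \<in> lists \<Sigma>"
  shows "q \<in> states A"
  using assms(2-)
proof (induction w arbitrary: p)
  case (Cons a w)
  then obtain r where "r \<in> trans A p a" "nfa_path A r w q" by auto
  moreover have "trans A p a \<subseteq> states A"
    using assms(1) Cons.prems by (simp add: nfa_over_def)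
  ultimately show ?case using Cons by auto
qed simp

text \<open>For each \<open>i\<close>, choose a state \<open>r i\<close> reached after
  \<open>x i\<close> on an accepting run on \<open>x i @ y i\<close>. If \<open>r i = r j\<close>,
  the first half of the run for \<open>i\<close> can be spliced with the second half of the run for
  \<open>j\<close>, so \<open>x i @ y j\<close> is accepted. Hence \<open>r\<close> is injective on
  \<open>S\<close>.\<close>

lemma fooling_set_card_le_states:
  assumes A: "nfa_over \<Sigma> A"
    and acc: "\<And>i. i \<in> S \<Longrightarrow> x i @ y i \<in> nfa_language \<Sigma> A"
    and fool: "\<And>i j. i \<in> S \<Longrightarrow> j \<in> S \<Longrightarrow> x i @ y j \<in> nfa_language \<Sigma> A \<Longrightarrow> i = j"
  shows "card S \<le> card (states A)"
proof -
  have "\<exists>r. r \<in> states A \<and> (\<exists>p\<in>initial A. nfa_path A p (x i) r) \<and> (\<exists>q\<in>accepting A. nfa_path A r (y i) q)"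
    if i: "i \<in> S" for i
  proof -
    obtain p q r where *: "p \<in> initial A" "q \<in> accepting A" "nfa_path A p (x i) r" "nfa_path A r (y i) q"
      using acc[OF i] by (auto simp: nfa_language_def nfa_path_append)
    have "r \<in> states A"
      using nfa_path_in_states[OF A *(3)] *(1) A acc[OF i] by (auto simp: nfa_over_def nfa_language_def)
    with * show ?thesis by blast
  qed
  then obtain r where r: "\<And>i. i \<in> S \<Longrightarrow> r i \<in> states A"
      "\<And>i. i \<in> S \<Longrightarrow> \<exists>p\<in>initial A. nfa_path A p (x i) (r i)"
      "\<And>i. i \<in> S \<Longrightarrow> \<exists>q\<in>accepting A. nfa_path A (r i) (y i) q"
    by metis
  have "inj_on r S"
  proof (rule inj_onI)
    fix i j assume ij: "i \<in> S" "j \<in> S" and eq: "r i = r j"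
    have "x i \<in> lists \<Sigma>" "y j \<in> lists \<Sigma>"
      using acc[OF ij(1)] acc[OF ij(2)] by (auto simp: nfa_language_def)
    moreover have "\<exists>p\<in>initial A. \<exists>q\<in>accepting A. nfa_path A p (x i @ y j) q"
      using r(2)[OF ij(1)] r(3)[OF ij(2)] eq by (metis nfa_path_append)
    ultimately have "x i @ y j \<in> nfa_language \<Sigma> A"
      by (simp add: nfa_language_def)
    with ij show "i = j" by (rule fool)
  qed
  then show ?thesis
    using r(1) A by (intro card_inj_on_le[of r]) (auto simp: nfa_over_def)
qed

lemma lasso_snth_add_period:
  assumes "v \<noteq> []" "length u \<le> i"
  shows "(u @- cycle v) !! (i + length v) = (u @- cycle v) !! i"
proof -
  have "cycle v !! (j + length v) = cycle v !! j" for j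
    by (subst cycle_decomp[OF assms(1)]) simp
  from this[of "i - length u"] show ?thesis
    using assms(2) by (simp add: shift_snth)
qed

text \<open>The letter \<open>b\<close> at position \<open>m\<close> of the first \<open>y\<close>
  is the witness against a shorter loop: one loop length before it or after it lies a letter of a
  block of \<open>a\<close>'s. The bound on \<open>length z\<close> ensures that one of the two
  always happens.\<close>

lemma lasso_prefix_eq:
  fixes a b :: 'b and z :: "'b list" and m :: nat
  defines "y \<equiv> replicate m a @ b # z"
  assumes "a \<noteq> b" and z: "length z \<le> m"
    and v: "v \<noteq> []" and len: "length (u @ v) = length y" "length x = length y"
    and eq: "u @- cycle v = (x @ y @ y) @- t"
  shows "x = y"
proof -
  define s where "s = u @- cycle v"
  define k where "k = length y"
  define p where "p = length v"
  have k: "k = Suc (m + length z)" by (simp add: k_def y_def)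
  have p: "0 < p" "p \<le> k" using v len by (auto simp: p_def k_def)
  \<comment> \<open>The loop is entered at position \<open>length u = k - p\<close>, which is inside
    \<open>x\<close>, so both copies of \<open>y\<close> lie in the periodic part.\<close>
  have per: "s !! (i + p) = s !! i" if "k - p \<le> i" for i
    unfolding s_def p_def using v len that by (intro lasso_snth_add_period) (auto simp: k_def p_def)
  have s0: "s !! i = x ! i" if "i < k" for i
    using that len by (simp add: s_def eq shift_snth k_def)
  have s1: "s !! (k + i) = y ! i" if "i < k" for i
    using that len by (simp add: s_def eq shift_snth k_def)
  have s2: "s !! (k + (k + i)) = y ! i" if "i < k" for i
    using that len by (simp add: s_def eq shift_snth k_def)
  have ya: "y ! i = a" if "i < m" for i
    using that by (simp add: y_def nth_append)
  have yb: "y ! m = b" by (simp add: y_def nth_append)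
  have "p = k"
  proof (rule ccontr)
    assume "p \<noteq> k"
    with p have "p < k" by simp
    show False
    proof (cases "p \<le> m")
      case True
      \<comment> \<open>A short loop: going back \<open>p\<close> from the \<open>b\<close> of the
        first copy stays in the block of \<open>a\<close>'s before it.\<close>
      have "s !! (k + m) = s !! (k + (m - p))"
        using per[of "k + (m - p)"] True by simp
      moreover have "m < k" "m - p < k" "m - p < m"
        using True p k by linarith+
      ultimately show False
        using s1[of m] s1[of "m - p"] ya[of "m - p"] yb \<open>a \<noteq> b\<close> by metis
    next
      case False
      \<comment> \<open>A longer loop: going forward \<open>p\<close> from that \<open>b\<close>
        reaches offset \<open>i\<close> of the second copy. The subtraction does not truncate,
        because \<open>m < p\<close> and \<open>k \<le> 2 * m + 1\<close>; \<open>p < k\<close> puts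
        \<open>i\<close> inside the block of \<open>a\<close>'s.\<close>
      define i where "i = m + p - k"
      have i: "k + m + p = k + (k + i)" "i < m"
        using False \<open>p < k\<close> k z by (auto simp: i_def)
      have "s !! (k + (k + i)) = s !! (k + m)"
        using per[of "k + m"] i by simp
      then show False
        using s1[of m] s2[of i] ya[of i] yb i k \<open>a \<noteq> b\<close> by simp
    qed
  qed
  \<comment> \<open>With \<open>p = k\<close> the stem \<open>u\<close> is empty, so the period
    holds from position 0 and carries \<open>x\<close> onto the first copy of
    \<open>y\<close>.\<close>
  show "x = y"
  proof (rule nth_equalityI)
    fix i assume "i < length x"
    then have "i < k" using len by (simp add: k_def)
    then show "x ! i = y ! i"
      using per[of i] s0[of i] s1[of i] \<open>p = k\<close> by (simp add: add.commute)
  qed (fact len(2))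
qed

text \<open>The lasso is \<open>cycle y\<close>, with empty stem and loop \<open>y\<close>. Its
  letters are subsets of \<open>I\<close>, so projection leaves it unchanged.\<close>

lemma cube_in_lasso_prefixes:
  assumes y: "y \<in> lists (Pow I)" "y \<noteq> []" and I: "I \<subseteq> AP"
  shows "y @ y @ y \<in> lasso_prefixes (length y) I AP"
proof -
  have "sset (cycle y) = set y"
    using y(2) by (rule sset_cycle)
  then have \<sigma>: "cycle y \<in> streams (Pow AP)" and id: "proj I (cycle y) = cycle y"
    using y(1) I unfolding proj_def
    by (auto simp: streams_iff_sset intro!: stream.map_ident_strong)
  have "cycle y = (y @ y @ y) @- cycle y"
    using cycle_decomp[OF y(2)] by (metis shift_append)
  then have "y @ y @ y = stake (length (y @ y @ y)) (cycle y)"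
    by (metis stake_shift order_refl diff_self_eq_0 stake.simps(1) append_Nil2 take_all)
  moreover have "cycle y \<in> lasso_words (length y) I (streams (Pow AP))"
    using \<sigma> id y by (force simp: lasso_words_def intro: bexI[of _ "[]"] bexI[of _ y])
  moreover have "y @ y @ y \<in> lists (Pow AP)"
    using y(1) I by auto
  ultimately show ?thesis by (auto simp: lasso_prefixes_def)
qed

text \<open>Projection onto \<open>I\<close> fixes every letter of \<open>w\<close>, so
  \<open>w\<close> is a prefix of the projected stream, which is the lasso itself.\<close>

lemma lasso_prefixesE:
  assumes "w \<in> lasso_prefixes k I AP" "w \<in> lists (Pow I)"
  obtains u v t where "v \<noteq> []" "length (u @ v) = k" "u @- cycle v = w @- t"
proof -
  obtain \<sigma> n u v where w: "w = stake n \<sigma>" and uv: "v \<noteq> []" "length (u @ v) = k" "proj I \<sigma> = u @- cycle v"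
    using assms(1) by (auto simp: lasso_prefixes_def lasso_words_def)
  have "stake n (proj I \<sigma>) = map (\<lambda>a. a \<inter> I) w"
    by (simp add: w proj_def)
  also have "\<dots> = w"
    using assms(2) by (intro map_idI) auto
  finally have "u @- cycle v = w @- sdrop n (proj I \<sigma>)"
    using uv(3) by (metis stake_sdrop)
  with uv that show thesis by blast
qed

theorem theorem3:
  shows "\<exists>f :: nat \<Rightarrow> real. linear_lower_growth f \<and>
    (\<forall>(k :: nat) (AP :: 'a set) (I :: 'a set) (A :: ('q, 'a set) nfa).
       finite AP \<longrightarrow> I \<noteq> {} \<longrightarrow> I \<subseteq> AP \<longrightarrow>
       nfa_over (Pow AP) A \<longrightarrow>
       nfa_language (Pow AP) A = lasso_prefixes k I AP \<longrightarrow>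
       2 powr f k \<le> real (card (states A)))"
proof (intro exI conjI allI impI)
  \<comment> \<open>The exponent counts the free letters left after a block of length
    \<open>k div 2\<close> and one marker; at \<open>k = 0\<close> truncation makes it 0.\<close>
  let ?f = "\<lambda>k :: nat. real (k - k div 2 - 1)"
  \<comment> \<open>For \<open>k \<ge> 4\<close>,
    \<open>k - k div 2 - 1 \<ge> k/2 - 1 \<ge> k/4\<close>.\<close>
  have "\<forall>\<^sub>F k in sequentially. norm (?f k) \<ge> 1/4 * norm (real k)"
    using eventually_ge_at_top[of 4] by eventually_elim auto
  then show "linear_lower_growth ?f"
    unfolding linear_lower_growth_def by (auto intro!: landau_omega.bigI[of "1/4"])
  fix k :: nat and AP I :: "'a set" and A :: "('q, 'a set) nfa"
  assume I: "I \<noteq> {}" "I \<subseteq> AP" and A: "nfa_over (Pow AP) A"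
    and L: "nfa_language (Pow AP) A = lasso_prefixes k I AP"
  show "2 powr ?f k \<le> real (card (states A))"
  proof (cases "k = 0")
    case True
    \<comment> \<open>The bound is 1 here, and the state set is nonempty.\<close>
    then show ?thesis using A by (simp add: nfa_over_def Suc_le_eq card_gt_0_iff)
  next
    case False
    define n where "n = k - k div 2 - 1"
    \<comment> \<open>Since \<open>I\<close> is nonempty, \<open>{}\<close> and \<open>I\<close> are
      two distinct letters, both in \<open>Pow I\<close>.\<close>
    define S where "S = {z. set z \<subseteq> {{}, I} \<and> length z = n}"
    define y where "y = (\<lambda>z. replicate (k div 2) {} @ I # z)"
    have len: "length (y z) = k" if "z \<in> S" for z
      using that False by (auto simp: S_def y_def n_def)
    have yI: "y z \<in> lists (Pow I)" if "z \<in> S" for z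
      using that by (auto simp: S_def y_def)
    have "card S \<le> card (states A)"
    \<comment> \<open>Each cube is split after its first factor, so that crossing the pairs of
      \<open>z\<close> and \<open>z'\<close> gives \<open>y z @ y z' @ y z'\<close>, the shape
      handled by \<open>lasso_prefix_eq\<close>.\<close>
    proof (rule fooling_set_card_le_states[OF A])
      fix z assume "z \<in> S"
      then show "y z @ (y z @ y z) \<in> nfa_language (Pow AP) A"
        using cube_in_lasso_prefixes[of "y z" I AP] yI len False I L by force
    next
      fix z z' assume z: "z \<in> S" "z' \<in> S"
        and w: "y z @ (y z' @ y z') \<in> nfa_language (Pow AP) A"
      obtain u v t where "v \<noteq> []" "length (u @ v) = k" "u @- cycle v = (y z @ y z' @ y z') @- t"
        by (rule lasso_prefixesE[of "y z @ y z' @ y z'" k I AP]) (use w L yI z in auto)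
      moreover have "length z' \<le> k div 2"
        using z by (auto simp: S_def n_def)
      ultimately have "y z = y z'"
        using lasso_prefix_eq[of "{}" I z' "k div 2" v u "y z" t] I len z by (simp add: y_def)
      then show "z = z'" by (simp add: y_def)
    qed
    moreover have "card S = 2 ^ n"
      using I unfolding S_def by (subst card_lists_length_eq) (auto simp: numeral_2_eq_2)
    ultimately have "real (2 ^ n) \<le> real (card (states A))"
      by simp
    then show ?thesis
      unfolding n_def[symmetric] by (simp add: powr_realpow)
  qed
qed

end
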